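(* Let $A\in\mathbb{R}^{m\times n}$, $\bar x\in\mathbb{R}^n$, and consider the noisy phaseless measurements $y=|A\bar x|^2+\epsilon\in\mathbb{R}^m$, with $\sigma=\|\epsilon\|$. Assume that: (1) $R:\mathbb{R}^n\to\mathbb{R}\cup\{+\infty\}$ is proper, lower semicontinuous, convex and even; (2) for every $I\subset\{1,\dots,m\}$ with $|I|\ge m/2$, $\ker(A^I)\cap\mathcal D_R(\bar x)=\{0\}$; (3) $R$ is non-negative; (4) $\ker(R_\infty)\cap\ker(A)=\{0\}$. Suppose also that the regularization parameter $\lambda>0$ is chosen such that $$\lambda\to0\quad\text{and}\quad \sigma^2/\lambda\to0,\qquad\text{as }\sigma\to0 .$$ Then, for any minimizer $x^\star_{y,\lambda}$ of $x\mapsto\|y-|Ax|^2\|^2+\lambda R(x)$ over $\mathbb{R}^n$, $$|Ax^\star_{y,\lambda}|\to|A\bar x|,\qquad R(x^\star_{y,\lambda})\to R(\bar x)\qquad\text{and}\qquad \mathrm{dist}\big(x^\star_{y,\lambda},\{\pm\bar x\}\big)\to0\qquad\text{as }\sigma\to0 .$$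
   Context: $\|\cdot\|$ is the Euclidean norm; for vectors, $|\cdot|$ and squares are componentwise. $\mathrm{dist}(x,\{\pm\bar x\})=\min(\|x-\bar x\|,\|x+\bar x\|)$. $A^I$ is the submatrix of $A$ with rows indexed by $I$. The descent cone of $R$ at $\bar x$ is $\mathcal D_R(\bar x)=\bigcup_{t>0}\{z\in\mathbb{R}^n: R(\bar x+tz)\le R(\bar x)\}$. $R_\infty(z)=\liminf_{z'\to z,\ t\to+\infty}R(tz')/t$. For a function $f$, $\ker(f)=\{z: f(z)=0\}$; for a matrix, $\ker$ is the null space. Here $A$ and $\bar x$ are fixed while $\epsilon$ (hence $y$) and $\lambda$ vary.
   Formalization: The formal theorem adds the assumption R(x̄)<+∞; without it the claim fails, e.g. m=n=1, A=1, x̄=1, R the indicator function of {0}, where (1)–(4) hold but every minimizer is 0. *)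

theory Defs
  imports "HOL-Analysis.Analysis"
begin

text \<open>On \<open>real ^ 'm\<close> the library operations \<open>\<bar>v\<bar>\<close> and \<open>v\<^sup>2\<close> act componentwise.\<close>

lemma vec_abs_component: "\<bar>v :: real ^ 'm\<bar> $ i = \<bar>v $ i\<bar>"
  by (simp add: abs_vec_def)

lemma vec_square_component: "((v :: real ^ 'm)\<^sup>2) $ i = (v $ i)\<^sup>2"
  by (simp add: power2_eq_square)

text \<open>Extended-real-valued functions.  A function into \<open>\<real> \<union> {+\<infinity>}\<close> is an \<open>ereal\<close>-valued one
  that never takes the value \<open>-\<infinity>\<close>; this is part of properness.\<close>

definition proper_fun :: "('a \<Rightarrow> ereal) \<Rightarrow> bool" where
  "proper_fun R \<longleftrightarrow> (\<forall>x. R x \<noteq> -\<infinity>) \<and> (\<exists>x. R x \<noteq> \<infinity>)"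

definition lsc_fun :: "('a::topological_space \<Rightarrow> ereal) \<Rightarrow> bool" where
  "lsc_fun R \<longleftrightarrow> (\<forall>x. R x \<le> Liminf (at x) R)"

text \<open>The convention \<open>0 * \<infinity> = 0\<close> of \<open>ereal\<close> makes the endpoint cases \<open>u = 0\<close> and \<open>v = 0\<close>
  below trivial, as they should be.\<close>

definition ereal_convex_fun :: "('a::real_vector \<Rightarrow> ereal) \<Rightarrow> bool" where
  "ereal_convex_fun R \<longleftrightarrow>
     (\<forall>x y. \<forall>u\<ge>0. \<forall>v\<ge>0. u + v = 1 \<longrightarrow>
        R (u *\<^sub>R x + v *\<^sub>R y) \<le> ereal u * R x + ereal v * R y)"

definition even_fun :: "('a::uminus \<Rightarrow> 'b) \<Rightarrow> bool" where
  "even_fun R \<longleftrightarrow> (\<forall>x. R (- x) = R x)"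

definition descent_cone :: "('a::real_vector \<Rightarrow> ereal) \<Rightarrow> 'a \<Rightarrow> 'a set" where
  "descent_cone R xb = (\<Union>t\<in>{0<..}. {z. R (xb + t *\<^sub>R z) \<le> R xb})"

text \<open>As usual for lower limits in variational analysis, \<open>z' = z\<close> is allowed, hence \<open>nhds z\<close>
  and not \<open>at z\<close>.\<close>

definition recession_fun :: "('a::real_normed_vector \<Rightarrow> ereal) \<Rightarrow> 'a \<Rightarrow> ereal" where
  "recession_fun R z = Liminf (nhds z \<times>\<^sub>F at_top) (\<lambda>(z', t::real). R (t *\<^sub>R z') / ereal t)"

definition fun_ker :: "('a \<Rightarrow> 'b::zero) \<Rightarrow> 'a set" where
  "fun_ker f = {z. f z = 0}"

definition mat_ker :: "real ^ 'n ^ 'm \<Rightarrow> (real ^ 'n) set" where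
  "mat_ker A = {z. A *v z = 0}"

text \<open>The null space of the submatrix of \<open>A\<close> with rows indexed by \<open>I\<close>: the components of the
  submatrix applied to \<open>z\<close> are the components of \<open>A *v z\<close> with index in \<open>I\<close>.\<close>

definition submat_ker :: "real ^ 'n ^ 'm \<Rightarrow> 'm set \<Rightarrow> (real ^ 'n) set" where
  "submat_ker A I = {z. \<forall>i\<in>I. (A *v z) $ i = 0}"

definition phaseless_objective ::
    "real ^ 'n ^ 'm \<Rightarrow> (real ^ 'n \<Rightarrow> ereal) \<Rightarrow> real ^ 'm \<Rightarrow> real \<Rightarrow> real ^ 'n \<Rightarrow> ereal" where
  "phaseless_objective A R y l x =
     ereal ((norm (y - \<bar>A *v x\<bar>\<^sup>2))\<^sup>2) + ereal l * R x"

definition dist_pm :: "'a::real_normed_vector \<Rightarrow> 'a \<Rightarrow> real" where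
  "dist_pm x xb = min (norm (x - xb)) (norm (x + xb))"

text \<open>In the theorem, the noise \<open>\<epsilon>\<close>, the parameter \<open>lam\<close> and the chosen minimizer \<open>x\<close> are families
  over an arbitrary index type, and limits are along an arbitrary filter \<open>F\<close> on it for which the
  noise level \<open>\<sigma> = norm (\<epsilon> k)\<close> tends to \<open>0\<close>.  This comprises sequences of instances as well as
  parameter choice rules depending on \<open>\<sigma>\<close> or on \<open>\<epsilon>\<close>.  The assumption \<open>R xb < \<infinity>\<close> is implicit in
  the notion of a descent cone at \<open>xb\<close>; without it the claim fails: for \<open>A = 1\<close> and \<open>xb = 1\<close> in
  dimension one and \<open>R\<close> the indicator function of \<open>{0}\<close> (with values \<open>0\<close> and \<open>\<infinity>\<close>), the minimizer
  is always \<open>0\<close>.\<close>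

end

theory Submission
  imports Defs
begin

text \<open>Comparing a minimizer with \<open>xb\<close> bounds both the residual and \<open>R\<close> at the minimizer, which
  gives \<open>\<bar>A *v x k\<bar> \<longlongrightarrow> \<bar>A *v xb\<bar>\<close> and \<open>limsup R (x k) \<le> R xb\<close>.  A normalized unbounded
  sequence of minimizers would accumulate at a unit vector in the kernels of \<open>A\<close> and of the
  recession function, so the minimizers stay bounded.  Each of their accumulation points \<open>p\<close> satisfies
  \<open>\<bar>A *v p\<bar> = \<bar>A *v xb\<bar>\<close> and \<open>R p \<le> R xb\<close>; as \<open>A *v p\<close> agrees with \<open>A *v xb\<close> or with
  \<open>- (A *v xb)\<close> on at least half of the rows, the descent cone condition forces \<open>p = \<plusminus>xb\<close>.\<close>

section \<open>Lower semicontinuity along filters\<close>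

lemma lsc_fun_eventually_gt:
  assumes "lsc_fun R" and "c < R x"
  shows "\<forall>\<^sub>F z in nhds x. c < R z"
proof -
  have "R x \<le> Liminf (at x) R"
    using assms(1) by (simp add: lsc_fun_def)
  then have "c < Liminf (at x) R"
    using assms(2) by simp
  then have "\<forall>\<^sub>F z in at x. c < R z"
    by (rule less_LiminfD)
  \<comment> \<open>\<open>lsc_fun\<close> speaks of the punctured filter \<open>at x\<close>; the
    assumption \<open>c < R x\<close> adds the point itself, so families that hit \<open>x\<close>
    are covered too.\<close>
  then show ?thesis
    using assms(2) by (simp add: eventually_nhds_conv_at)
qed

text \<open>Otherwise a value \<open>d\<close> strictly between \<open>c\<close> and
  \<open>R p\<close> would eventually lie below \<open>R (u k)\<close> and above
  \<open>f k\<close>.\<close>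

lemma lsc_fun_limit_le:
  fixes R :: "'a::topological_space \<Rightarrow> ereal"
  assumes "lsc_fun R" and "G \<noteq> bot" and "(u \<longlongrightarrow> p) G" and "(f \<longlongrightarrow> c) G"
    and "\<forall>\<^sub>F k in G. R (u k) \<le> f k"
  shows "R p \<le> c"
proof (rule ccontr)
  assume "\<not> R p \<le> c"
  then obtain d where d: "c < d" "d < R p"
    using dense by (metis not_le)
  have "\<forall>\<^sub>F k in G. d < R (u k)"
    using lsc_fun_eventually_gt[OF assms(1) d(2)] assms(3) by (rule eventually_compose_filterlim)
  moreover have "\<forall>\<^sub>F k in G. f k < d"
    using assms(4) d(1) by (rule order_tendstoD)
  ultimately have "\<forall>\<^sub>F k in G. False"
    using assms(5) by eventually_elim auto
  then show False
    using assms(2) by simp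
qed

section \<open>Recession function and bounded sublevel sets\<close>

lemma recession_fun_nonneg:
  assumes "\<And>z. R z \<ge> 0"
  shows "recession_fun R z \<ge> 0"
proof -
  have "\<forall>\<^sub>F p in nhds z \<times>\<^sub>F at_top. (0::real) < snd p"
    by (rule eventually_compose_filterlim[OF eventually_gt_at_top filterlim_snd])
  then show ?thesis
    unfolding recession_fun_def
    by (intro Liminf_bounded) (auto elim!: eventually_mono intro!: zero_le_divide_ereal assms)
qed

text \<open>The pairs of direction and norm of \<open>u n\<close> run along the filter that defines
  \<open>recession_fun R z\<close>. On them the quotient is \<open>R (u n)\<close> over
  \<open>norm (u n)\<close>, at most \<open>M / norm (u n)\<close>, so it cannot stay above a
  positive constant.\<close>

lemma recession_fun_le_zero:
  fixes u :: "nat \<Rightarrow> 'a::real_normed_vector"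
  assumes "filterlim (\<lambda>n. norm (u n)) at_top sequentially"
    and "(\<lambda>n. u n /\<^sub>R norm (u n)) \<longlonglongrightarrow> z"
    and "\<And>n. R (u n) \<le> ereal M"
  shows "recession_fun R z \<le> 0"
proof (rule ccontr)
  assume "\<not> recession_fun R z \<le> 0"
  then obtain c where c: "0 < ereal c" "ereal c < recession_fun R z"
    using ereal_dense2 by (metis not_le)
  have "\<forall>\<^sub>F (z', t) in nhds z \<times>\<^sub>F at_top. ereal c < R (t *\<^sub>R z') / ereal t"
    using less_LiminfD[OF c(2)[unfolded recession_fun_def]] by (simp add: case_prod_unfold)
  moreover have "filterlim (\<lambda>n. (u n /\<^sub>R norm (u n), norm (u n))) (nhds z \<times>\<^sub>F at_top) sequentially"
    using assms(1,2) by (intro filterlim_Pair)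
  ultimately have "\<forall>\<^sub>F n in sequentially. case (u n /\<^sub>R norm (u n), norm (u n)) of
      (z', t) \<Rightarrow> ereal c < R (t *\<^sub>R z') / ereal t"
    by (rule eventually_compose_filterlim)
  \<comment> \<open>Positivity lets the rescaling cancel; exceeding \<open>M / c\<close> contradicts
    \<open>c < M / norm (u n)\<close>.\<close>
  moreover have "\<forall>\<^sub>F n in sequentially. norm (u n) > max 0 (M / c)"
    using assms(1) unfolding filterlim_at_top_dense by blast
  ultimately have "\<forall>\<^sub>F n in sequentially. False"
  proof eventually_elim
    case (elim n)
    have "ereal c < R (u n) / ereal (norm (u n))"
      using elim by simp
    also have "\<dots> \<le> ereal M / ereal (norm (u n))"
      using elim assms(3) by (intro ereal_divide_right_mono) auto
    finally have "c < M / norm (u n)"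
      using elim by simp
    then show ?case
      using elim c(1) by (simp add: field_simps)
  qed
  then show False
    by simp
qed

text \<open>Supplies the compactness for extracting limits of minimizers. Along an escaping sequence
  both bounds become negligible after normalization, which puts the limiting direction in both
  kernels.\<close>

lemma bounded_sublevel_set:
  fixes A :: "real ^ 'n ^ 'm" and R :: "real ^ 'n \<Rightarrow> ereal"
  assumes "\<And>z. R z \<ge> 0" and "fun_ker (recession_fun R) \<inter> mat_ker A = {0}"
  shows "bounded {z. R z \<le> ereal M \<and> norm (A *v z) \<le> N}"
proof (rule ccontr)
  assume "\<not> ?thesis"
  then have "\<forall>n::nat. \<exists>z. R z \<le> ereal M \<and> norm (A *v z) \<le> N \<and> real n + 1 < norm z"
    unfolding bounded_iff by (metis (mono_tags, lifting) mem_Collect_eq not_le)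
  then obtain u where u: "\<And>n. R (u n) \<le> ereal M" "\<And>n. norm (A *v u n) \<le> N"
      "\<And>n::nat. real n + 1 < norm (u n)"
    by metis
  have "(u n /\<^sub>R norm (u n)) \<in> sphere 0 1" for n
    using u(3)[of n] by (cases "u n = 0") auto
  then obtain z r where z: "z \<in> sphere 0 1" and r: "strict_mono r"
    and lim: "((\<lambda>n. u n /\<^sub>R norm (u n)) \<circ> r) \<longlonglongrightarrow> z"
    using compact_sphere[of "0 :: real ^ 'n" 1] unfolding compact_def by meson
  define v where "v = u \<circ> r"
  have limv: "(\<lambda>n. v n /\<^sub>R norm (v n)) \<longlonglongrightarrow> z"
    using lim by (simp add: v_def o_def)
  have "real n \<le> norm (v n)" for n
    using u(3)[of "r n"] strict_mono_imp_increasing[OF r, of n] by (simp add: v_def)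
  then have nv: "filterlim (\<lambda>n. norm (v n)) at_top sequentially"
    by (intro filterlim_at_top_mono[OF filterlim_real_sequentially]) auto
  \<comment> \<open>The growth argument gives only an upper bound; nonnegativity of \<open>R\<close>
    turns it into membership in \<open>fun_ker\<close>.\<close>
  have "recession_fun R z = 0"
    using recession_fun_le_zero[OF nv limv, of R M] u(1) recession_fun_nonneg[of R z, OF assms(1)]
    by (intro antisym) (auto simp: v_def)
  moreover have "A *v z = 0"
  proof -
    have "(\<lambda>n. A *v (v n /\<^sub>R norm (v n))) \<longlonglongrightarrow> A *v z"
      using limv by (rule bounded_linear.tendsto[OF matrix_vector_mul_bounded_linear])
    moreover have "(\<lambda>n. A *v (v n /\<^sub>R norm (v n))) \<longlonglongrightarrow> 0"
    proof (rule Lim_null_comparison)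
      show "\<forall>\<^sub>F n in sequentially. norm (A *v (v n /\<^sub>R norm (v n))) \<le> N / norm (v n)"
        using u(2) by (auto simp: v_def matrix_vector_mult_scaleR divide_inverse
            mult.commute[of N] intro!: always_eventually mult_left_mono)
      show "(\<lambda>n. N / norm (v n)) \<longlonglongrightarrow> 0"
        using nv by (intro tendsto_divide_0[OF tendsto_const] filterlim_at_top_imp_at_infinity)
    qed
    ultimately show ?thesis
      by (rule LIMSEQ_unique)
  qed
  ultimately have "z = 0"
    using assms(2) by (auto simp: fun_ker_def mat_ker_def)
  then show False
    using z by simp
qed

section \<open>Uniqueness up to sign\<close>

lemma phaseless_exact_recovery:
  fixes A :: "real ^ 'n ^ 'm" and R :: "real ^ 'n \<Rightarrow> ereal"
  assumes "even_fun R"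
    and "\<And>I :: 'm set. real (card I) \<ge> real CARD('m) / 2 \<Longrightarrow>
           submat_ker A I \<inter> descent_cone R xb = {0}"
    and "\<bar>A *v p\<bar> = \<bar>A *v xb\<bar>" and "R p \<le> R xb"
  shows "p = xb \<or> p = - xb"
proof -
  \<comment> \<open>The difference \<open>q - xb\<close> is annihilated by the agreeing rows and is
    a descent direction with \<open>t = 1\<close>. A general \<open>q\<close> allows use for both
    \<open>p\<close> and \<open>- p\<close>.\<close>
  have unique: "q = xb" if "R q \<le> R xb"
    and "real (card {i. (A *v q) $ i = (A *v xb) $ i}) \<ge> real CARD('m) / 2" for q
  proof -
    have "q - xb \<in> submat_ker A {i. (A *v q) $ i = (A *v xb) $ i}"
      by (simp add: submat_ker_def matrix_vector_mult_diff_distrib)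
    moreover have "q - xb \<in> descent_cone R xb"
      using that(1) by (auto simp: descent_cone_def intro!: bexI[of _ 1])
    ultimately have "q - xb \<in> {0}"
      using assms(2)[OF that(2)] by blast
    then show ?thesis
      by simp
  qed
  \<comment> \<open>Equal moduli mean equality up to sign in each row, so these sets cover all rows
    and one contains at least half. They overlap where the entries vanish, hence only an inequality
    of cardinalities.\<close>
  let ?P = "{i. (A *v p) $ i = (A *v xb) $ i}" and ?Q = "{i. (A *v (- p)) $ i = (A *v xb) $ i}"
  have neg: "A *v (- p) = - (A *v p)"
    using matrix_vector_mult_diff_distrib[of A 0 p] by simp
  have "i \<in> ?P \<union> ?Q" for i
  proof -
    have "\<bar>(A *v p) $ i\<bar> = \<bar>(A *v xb) $ i\<bar>"
      using assms(3) by (metis vec_abs_component)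
    then show ?thesis
      unfolding neg by (auto simp: abs_eq_iff)
  qed
  then have "?P \<union> ?Q = UNIV"
    by blast
  then have "CARD('m) \<le> card ?P + card ?Q"
    using card_Un_le[of ?P ?Q] by metis
  then consider "real (card ?P) \<ge> real CARD('m) / 2" | "real (card ?Q) \<ge> real CARD('m) / 2"
    by linarith
  then show ?thesis
  proof cases
    case 1
    then show ?thesis using unique assms(4) by blast
  next
    case 2
    then have "- p = xb"
      using unique[of "- p"] assms(1,4) by (simp add: even_fun_def)
    then show ?thesis by auto
  qed
qed

section \<open>Limits of moduli and bounds at a minimizer\<close>

lemma norm_vec_abs: "norm \<bar>v :: real ^ 'm\<bar> = norm v"
  by (simp add: norm_vec_def vec_abs_component)

lemma tendsto_vec_abs:
  fixes f :: "'k \<Rightarrow> real ^ 'm"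
  assumes "(f \<longlongrightarrow> l) F"
  shows "((\<lambda>k. \<bar>f k\<bar>) \<longlongrightarrow> \<bar>l\<bar>) F"
  by (rule vec_tendstoI, unfold vec_abs_component) (intro tendsto_rabs tendsto_vec_nth assms)

text \<open>The square root is continuous also at 0, so vanishing components need no separate
  treatment.\<close>

lemma tendsto_vec_abs_of_square:
  fixes f :: "'k \<Rightarrow> real ^ 'm"
  assumes "((\<lambda>k. \<bar>f k\<bar>\<^sup>2) \<longlongrightarrow> \<bar>l\<bar>\<^sup>2) F"
  shows "((\<lambda>k. \<bar>f k\<bar>) \<longlongrightarrow> \<bar>l\<bar>) F"
proof (rule vec_tendstoI)
  fix i
  have "((\<lambda>k. (\<bar>f k\<bar>\<^sup>2) $ i) \<longlongrightarrow> (\<bar>l\<bar>\<^sup>2) $ i) F"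
    using assms by (rule tendsto_vec_nth)
  then have "((\<lambda>k. sqrt ((f k $ i)\<^sup>2)) \<longlongrightarrow> sqrt ((l $ i)\<^sup>2)) F"
    by (intro tendsto_real_sqrt) (simp add: vec_square_component vec_abs_component)
  then show "((\<lambda>k. \<bar>f k\<bar> $ i) \<longlongrightarrow> \<bar>l\<bar> $ i) F"
    by (simp add: vec_abs_component)
qed

text \<open>At \<open>xb\<close> the residual is exactly \<open>\<epsilon>\<close>. Dropping the
  regularization term at \<open>x\<close> gives the first bound; dropping the residual and dividing
  by \<open>l\<close> gives the second.\<close>

lemma arg_min_phaseless_bounds:
  fixes A :: "real ^ 'n ^ 'm"
  assumes "is_arg_min (phaseless_objective A R y l) (\<lambda>_. True) x"
    and "l > 0" and "R x \<ge> 0" and "R xb = ereal rb" and "y = \<bar>A *v xb\<bar>\<^sup>2 + \<epsilon>"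
  shows "(norm (y - \<bar>A *v x\<bar>\<^sup>2))\<^sup>2 \<le> (norm \<epsilon>)\<^sup>2 + l * rb"
    and "R x \<le> ereal (rb + (norm \<epsilon>)\<^sup>2 / l)"
proof -
  have "phaseless_objective A R y l x \<le> phaseless_objective A R y l xb"
    using assms(1) by (auto simp: is_arg_min_def not_less)
  then have *: "ereal ((norm (y - \<bar>A *v x\<bar>\<^sup>2))\<^sup>2) + ereal l * R x \<le> ereal ((norm \<epsilon>)\<^sup>2 + l * rb)"
    using assms(4,5) by (simp add: phaseless_objective_def)
  \<comment> \<open>As \<open>l > 0\<close>, an infinite \<open>R x\<close> would violate the finite
    bound, so the rest is real arithmetic.\<close>
  with assms(2,3) obtain r where r: "R x = ereal r"
    by (cases "R x") auto
  then have le: "(norm (y - \<bar>A *v x\<bar>\<^sup>2))\<^sup>2 + l * r \<le> (norm \<epsilon>)\<^sup>2 + l * rb" and "r \<ge> 0"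
    using * assms(3) by auto
  have "0 \<le> l * r"
    using assms(2) \<open>r \<ge> 0\<close> by simp
  with le show "(norm (y - \<bar>A *v x\<bar>\<^sup>2))\<^sup>2 \<le> (norm \<epsilon>)\<^sup>2 + l * rb"
    by linarith
  have "l * r \<le> (norm \<epsilon>)\<^sup>2 + l * rb"
    using le zero_le_power2[of "norm (y - \<bar>A *v x\<bar>\<^sup>2)"] by linarith
  then show "R x \<le> ereal (rb + (norm \<epsilon>)\<^sup>2 / l)"
    using assms(2) by (simp add: r field_simps)
qed

section \<open>Convergence along the filter\<close>

theorem theorem5p2:
  fixes A :: "real ^ 'n ^ 'm"
    and xb :: "real ^ 'n"
    and R :: "real ^ 'n \<Rightarrow> ereal"
    and F :: "'k filter"
    and \<epsilon> y :: "'k \<Rightarrow> real ^ 'm"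
    and \<sigma> lam :: "'k \<Rightarrow> real"
    and x :: "'k \<Rightarrow> real ^ 'n"
  assumes "proper_fun R" and "lsc_fun R" and "ereal_convex_fun R" and "even_fun R"
    and "R xb < \<infinity>"
    and "\<And>I :: 'm set. real (card I) \<ge> real CARD('m) / 2 \<Longrightarrow>
           submat_ker A I \<inter> descent_cone R xb = {0}"
    and "\<And>z. R z \<ge> 0"
    and "fun_ker (recession_fun R) \<inter> mat_ker A = {0}"
    and "\<And>k. y k = \<bar>A *v xb\<bar>\<^sup>2 + \<epsilon> k"
    and "\<And>k. \<sigma> k = norm (\<epsilon> k)"
    and "(\<sigma> \<longlongrightarrow> 0) F"
    and "\<forall>\<^sub>F k in F. lam k > 0"
    and "(lam \<longlongrightarrow> 0) F"
    and "((\<lambda>k. (\<sigma> k)\<^sup>2 / lam k) \<longlongrightarrow> 0) F"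
    and "\<forall>\<^sub>F k in F. is_arg_min (phaseless_objective A R (y k) (lam k)) (\<lambda>_. True) (x k)"
  shows "((\<lambda>k. \<bar>A *v x k\<bar>) \<longlongrightarrow> \<bar>A *v xb\<bar>) F \<and>
         ((\<lambda>k. R (x k)) \<longlongrightarrow> R xb) F \<and>
         ((\<lambda>k. dist_pm (x k) xb) \<longlongrightarrow> 0) F"
proof (intro conjI)
  obtain rb where rb: "R xb = ereal rb"
    using assms(5) assms(7)[of xb] by (cases "R xb") auto
  have \<epsilon>0: "(\<epsilon> \<longlongrightarrow> 0) F"
    using assms(11) unfolding assms(10) by (rule tendsto_norm_zero_cancel)
  note bounds = arg_min_phaseless_bounds[where R = R and xb = xb, OF _ _ assms(7) rb assms(9)]
  have res_le: "\<forall>\<^sub>F k in F. (norm (y k - \<bar>A *v x k\<bar>\<^sup>2))\<^sup>2 \<le> (\<sigma> k)\<^sup>2 + lam k * rb"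
    unfolding assms(10) using assms(12,15)
    by eventually_elim (rule bounds(1))
  have R_le: "\<forall>\<^sub>F k in F. R (x k) \<le> ereal (rb + (\<sigma> k)\<^sup>2 / lam k)"
    unfolding assms(10) using assms(12,15)
    by eventually_elim (rule bounds(2))
  have rhs: "((\<lambda>k. (\<sigma> k)\<^sup>2 + lam k * rb) \<longlongrightarrow> 0) F"
    using tendsto_add[OF tendsto_power[OF assms(11), of 2] tendsto_mult_left_zero[OF assms(13), of rb]]
    by simp
  have bound_lim: "((\<lambda>k. rb + (\<sigma> k)\<^sup>2 / lam k) \<longlongrightarrow> rb) F"
    using tendsto_add[OF tendsto_const[of rb] assms(14)] by simp

  have "((\<lambda>k. (norm (y k - \<bar>A *v x k\<bar>\<^sup>2))\<^sup>2) \<longlongrightarrow> 0) F"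
    by (rule tendsto_sandwich[OF _ res_le tendsto_const rhs]) simp
  then have "((\<lambda>k. sqrt ((norm (y k - \<bar>A *v x k\<bar>\<^sup>2))\<^sup>2)) \<longlongrightarrow> sqrt 0) F"
    by (rule tendsto_real_sqrt)
  then have "((\<lambda>k. y k - \<bar>A *v x k\<bar>\<^sup>2) \<longlongrightarrow> 0) F"
    by (simp add: tendsto_norm_zero_iff)
  \<comment> \<open>Subtracting the residual from \<open>y k\<close> leaves the squared
    moduli.\<close>
  from tendsto_diff[OF tendsto_add[OF tendsto_const[of "\<bar>A *v xb\<bar>\<^sup>2"] \<epsilon>0] this]
  have "((\<lambda>k. \<bar>A *v x k\<bar>\<^sup>2) \<longlongrightarrow> \<bar>A *v xb\<bar>\<^sup>2) F"
    by (simp add: assms(9))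
  then show Ax: "((\<lambda>k. \<bar>A *v x k\<bar>) \<longlongrightarrow> \<bar>A *v xb\<bar>) F"
    by (rule tendsto_vec_abs_of_square)

  \<comment> \<open>The slack 1 dominates every tolerance \<open>inverse (real (Suc n))\<close> used
    below.\<close>
  define S where "S = {z. R z \<le> ereal (rb + 1) \<and> norm (A *v z) \<le> norm (A *v xb) + 1}"
  have "bounded S"
    unfolding S_def by (rule bounded_sublevel_set[OF assms(7,8)])
  have near: "\<forall>\<^sub>F k in F. R (x k) \<le> ereal (rb + d) \<and> norm (\<bar>A *v x k\<bar> - \<bar>A *v xb\<bar>) < d"
    if "d > 0" for d
  proof -
    have "\<forall>\<^sub>F k in F. rb + (\<sigma> k)\<^sup>2 / lam k < rb + d"
      using that by (intro order_tendstoD(2)[OF bound_lim]) simp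
    moreover have "\<forall>\<^sub>F k in F. norm (\<bar>A *v x k\<bar> - \<bar>A *v xb\<bar>) < d"
      using tendstoD[OF Ax that] by (simp add: dist_norm)
    ultimately show ?thesis
      using R_le by eventually_elim (auto elim!: order_trans)
  qed
  show dist0: "((\<lambda>k. dist_pm (x k) xb) \<longlongrightarrow> 0) F"
  proof (rule ccontr)
    assume "\<not> ?thesis"
    then obtain e where e: "e > 0" and "\<not> (\<forall>\<^sub>F k in F. dist_pm (x k) xb < e)"
      by (auto simp: tendsto_iff dist_pm_def)
    then have freq: "\<exists>\<^sub>F k in F. e \<le> dist_pm (x k) xb"
      by (simp add: frequently_def not_le)
    \<comment> \<open>\<open>F\<close> need not have a countable base, so no sequence of indices
      tending along \<open>F\<close> is sought. For each tolerance one far minimizer is picked, and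
      these points form an ordinary sequence.\<close>
    have "\<exists>z. e \<le> dist_pm z xb \<and> R z \<le> ereal (rb + inverse (real (Suc n))) \<and>
        norm (\<bar>A *v z\<bar> - \<bar>A *v xb\<bar>) < inverse (real (Suc n))" for n
      using frequently_ex[OF frequently_eventually_frequently[OF freq near[of "inverse (real (Suc n))"]]]
      by auto
    then obtain u where u: "\<And>n. e \<le> dist_pm (u n) xb"
        "\<And>n. R (u n) \<le> ereal (rb + inverse (real (Suc n)))"
        "\<And>n. norm (\<bar>A *v u n\<bar> - \<bar>A *v xb\<bar>) < inverse (real (Suc n))"
      by metis
    have "u n \<in> S" for n
    proof -
      have le1: "inverse (real (Suc n)) \<le> 1"
        by (simp add: field_simps)
      have "R (u n) \<le> ereal (rb + 1)"
        using u(2)[of n] le1 by (auto elim!: order_trans)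
      moreover have "norm \<bar>A *v u n\<bar> \<le> norm \<bar>A *v xb\<bar> + 1"
        using u(3)[of n] le1 norm_triangle_ineq2[of "\<bar>A *v u n\<bar>" "\<bar>A *v xb\<bar>"] by linarith
      ultimately show ?thesis
        by (simp add: S_def norm_vec_abs)
    qed
    then have "bounded (range u)"
      using \<open>bounded S\<close> by (auto intro: bounded_subset)
    then obtain p r where r: "strict_mono r" and p: "(u \<circ> r) \<longlonglongrightarrow> p"
      using bounded_imp_convergent_subsequence by metis
    have inv: "(\<lambda>n. inverse (real (Suc (r n)))) \<longlonglongrightarrow> 0"
      using LIMSEQ_subseq_LIMSEQ[OF LIMSEQ_inverse_real_of_nat r] by (simp add: o_def)
    have "R p \<le> R xb"
    proof (rule lsc_fun_limit_le[OF assms(2) _ p])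
      show "(\<lambda>n. ereal (rb + inverse (real (Suc (r n))))) \<longlonglongrightarrow> R xb"
        using tendsto_add[OF tendsto_const[of rb] inv] by (simp add: rb)
      show "\<forall>\<^sub>F n in sequentially. R ((u \<circ> r) n) \<le> ereal (rb + inverse (real (Suc (r n))))"
        using u(2) by simp
    qed simp
    moreover have "\<bar>A *v p\<bar> = \<bar>A *v xb\<bar>"
    proof (rule LIMSEQ_unique)
      show "(\<lambda>n. \<bar>A *v (u \<circ> r) n\<bar>) \<longlonglongrightarrow> \<bar>A *v p\<bar>"
        by (intro tendsto_vec_abs bounded_linear.tendsto[OF matrix_vector_mul_bounded_linear] p)
      have "(\<lambda>n. \<bar>A *v (u \<circ> r) n\<bar> - \<bar>A *v xb\<bar>) \<longlonglongrightarrow> 0"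
        by (rule Lim_null_comparison[OF _ inv]) (use u(3) in \<open>auto intro!: always_eventually less_imp_le\<close>)
      then show "(\<lambda>n. \<bar>A *v (u \<circ> r) n\<bar>) \<longlonglongrightarrow> \<bar>A *v xb\<bar>"
        by (rule LIM_zero_cancel)
    qed
    ultimately have "p = xb \<or> p = - xb"
      using phaseless_exact_recovery[OF assms(4,6)] by blast
    then have "dist_pm p xb = 0"
      by (auto simp: dist_pm_def min_def)
    \<comment> \<open>By continuity the separation \<open>e\<close> survives in the limit, against
      \<open>dist_pm p xb = 0\<close>.\<close>
    moreover have "(\<lambda>n. dist_pm ((u \<circ> r) n) xb) \<longlonglongrightarrow> dist_pm p xb"
      unfolding dist_pm_def by (intro tendsto_intros p)
    then have "e \<le> dist_pm p xb"
      by (rule LIMSEQ_le_const) (use u(1) in auto)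
    ultimately show False
      using e by simp
  qed

  show "((\<lambda>k. R (x k)) \<longlongrightarrow> R xb) F"
  proof (rule order_tendstoI)
    \<comment> \<open>Lower semicontinuity gives a ball around \<open>xb\<close> on which
      \<open>R\<close> exceeds \<open>c\<close>. Eventually \<open>x k\<close> or
      \<open>- x k\<close> lies in it, and evenness identifies their values.\<close>
    fix c assume "c < R xb"
    from lsc_fun_eventually_gt[OF assms(2) this]
    obtain d where d: "d > 0" "\<And>z. dist z xb < d \<Longrightarrow> c < R z"
      by (auto simp: eventually_nhds_metric)
    have "\<forall>\<^sub>F k in F. dist_pm (x k) xb < d"
      by (rule order_tendstoD(2)[OF dist0 d(1)])
    then show "\<forall>\<^sub>F k in F. c < R (x k)"
    proof eventually_elim
      case (elim k)
      then consider "dist (x k) xb < d" | "dist (- x k) xb < d"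
        by (auto simp: dist_pm_def dist_norm min_less_iff_disj norm_minus_commute add.commute
            norm_minus_cancel[of "x k + xb", symmetric] simp del: norm_minus_cancel)
      then show ?case
        using d(2)[of "x k"] d(2)[of "- x k"] assms(4) by cases (auto simp: even_fun_def)
    qed
  next
    fix c assume "R xb < c"
    moreover have "((\<lambda>k. ereal (rb + (\<sigma> k)\<^sup>2 / lam k)) \<longlongrightarrow> R xb) F"
      using bound_lim by (simp add: rb)
    ultimately have "\<forall>\<^sub>F k in F. ereal (rb + (\<sigma> k)\<^sup>2 / lam k) < c"
      by (intro order_tendstoD(2))
    then show "\<forall>\<^sub>F k in F. R (x k) < c"
      using R_le by eventually_elim (rule le_less_trans)
  qed
qed

end
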